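(* The metric $M_{MDL1}(\mathcal{G},\vec C)=\log p(\mathcal{G}^h)-N\cdot H(\mathcal{G},\vec C)-\frac12\mathrm{Dim}(\mathcal{G})\log N$, where $N$ is the number of cases in $\vec C$ and $p(\mathcal{G}^h)$ is the prior probability of the structure hypothesis $\mathcal{G}^h$, is score equivalent; that is, for all dags $\mathcal{G},\mathcal{G}'$ over the same set of variables, every database $\vec C$ and every prior $p$ on structure hypotheses, $\mathcal{G}\approx\mathcal{G}'$ implies $M_{MDL1}(\mathcal{G},\vec C)=M_{MDL1}(\mathcal{G}',\vec C)$.
   Context: All graphs have the same finite vertex set $U=\{x_1,\dots,x_n\}$; a dag is an acyclic directed graph on $U$. Each node $x_i$ is a discrete variable with a finite number $r_i\ge 2$ of states. $\Pi_i^{\mathcal{G}}$ denotes the set of parents of $x_i$ in $\mathcal{G}$. A Bayesian network with structure $\mathcal{G}$ is a pair $(\mathcal{G},\theta_{\mathcal{G}})$ where $\theta_{\mathcal{G}}$ is a collection of conditional distributions $p(x_i\mid\Pi_i^{\mathcal{G}})$; it defines the joint distribution $\prod_i p(x_i\mid\Pi_i^{\mathcal{G}})$. Two dags are equivalent, written $\mathcal{G}\approx\mathcal{G}'$, if for every Bayesian network $(\mathcal{G},\theta_{\mathcal{G}})$ there is a Bayesian network $(\mathcal{G}',\theta_{\mathcal{G}'})$ defining the same joint distribution, and vice versa. Known fact (Verma and Pearl): $\mathcal{G}\approx\mathcal{G}'$ if and only if they have the same skeleton (underlying undirected graph) and the same v-structures (ordered triples $(x,y,z)$ of distinct nodes with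 $x\to y$, $z\to y$ and $x,z$ not adjacent). A database $\vec C=\{C_1,\dots,C_N\}$, $N\ge1$, consists of $N$ cases, each a full assignment of states to all variables in $U$. The hypothesis $\mathcal{G}^h$ is the hypothesis that the data was generated by a distribution that can be factored according to $\mathcal{G}$; hence the hypotheses of equivalent dags are identical (hypothesis equivalence) and receive the same prior probability. (If a prior is $0$, use $\log 0=-\infty$.) $H(\mathcal{G},\vec C)$ is the entropy associated with parameterizing $\mathcal{G}$ by the observed fractions in the data: $H(\mathcal{G},\vec C)=-\sum_{i}\sum_{j}\sum_{k}\frac{N_{ijk}}{N}\log\frac{N_{ijk}}{N_{ij}}$, where $N_{ijk}$ is the number of cases in which $x_i$ is in state $k$ and $\Pi_i^{\mathcal{G}}$ is in its $j$-th joint configuration, $N_{ij}=\sum_kN_{ijk}$, and terms with $N_{ijk}=0$ are $0$. The number of parameters is $\mathrm{Dim}(\mathcal{G})=\sum_{i=1}^n(r_i-1)\prod_{x_j\in\Pi_i^{\mathcal{G}}}r_j$. *)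

theory Defs
  imports "HOL-Library.FuncSet" "HOL-Library.Extended_Real" Complex_Main
begin

text \<open>A graph on the finite vertex set \<open>U\<close> is its set of arcs, \<open>(y, x) \<in> E\<close> meaning \<open>y \<rightarrow> x\<close>.
  The states of the variable \<open>x\<close> are \<open>0, \<dots>, r x - 1\<close>.\<close>

definition dag :: "'v set \<Rightarrow> ('v \<times> 'v) set \<Rightarrow> bool" where
  "dag U E \<longleftrightarrow> E \<subseteq> U \<times> U \<and> acyclic E"

definition parents :: "('v \<times> 'v) set \<Rightarrow> 'v \<Rightarrow> 'v set" where
  "parents E x = {y. (y, x) \<in> E}"

definition configs :: "('v \<Rightarrow> nat) \<Rightarrow> 'v set \<Rightarrow> ('v \<Rightarrow> nat) set" where
  "configs r A = (\<Pi>\<^sub>E x\<in>A. {..<r x})"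

text \<open>\<open>\<theta> x c k\<close> is the probability that \<open>x\<close> is in state \<open>k\<close> given that its parents are in
  joint configuration \<open>c\<close>. Values outside the indicated ranges are unconstrained and
  never used.\<close>

definition bayes_params ::
  "'v set \<Rightarrow> ('v \<Rightarrow> nat) \<Rightarrow> ('v \<times> 'v) set \<Rightarrow> ('v \<Rightarrow> ('v \<Rightarrow> nat) \<Rightarrow> nat \<Rightarrow> real) \<Rightarrow> bool" where
  "bayes_params U r E \<theta> \<longleftrightarrow>
     (\<forall>x\<in>U. \<forall>c\<in>configs r (parents E x).
        (\<forall>k<r x. 0 \<le> \<theta> x c k) \<and> (\<Sum>k<r x. \<theta> x c k) = 1)"

text \<open>A joint distribution is a probability mass function on \<open>configs r U\<close>, made
  \<open>undefined\<close> elsewhere so that equality of functions is equality of distributions.\<close>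

definition joint_dist ::
  "'v set \<Rightarrow> ('v \<Rightarrow> nat) \<Rightarrow> ('v \<times> 'v) set \<Rightarrow> ('v \<Rightarrow> ('v \<Rightarrow> nat) \<Rightarrow> nat \<Rightarrow> real)
    \<Rightarrow> ('v \<Rightarrow> nat) \<Rightarrow> real" where
  "joint_dist U r E \<theta> =
     (\<lambda>a\<in>configs r U. \<Prod>x\<in>U. \<theta> x (restrict a (parents E x)) (a x))"

definition dag_equiv ::
  "'v set \<Rightarrow> ('v \<Rightarrow> nat) \<Rightarrow> ('v \<times> 'v) set \<Rightarrow> ('v \<times> 'v) set \<Rightarrow> bool" where
  "dag_equiv U r G G' \<longleftrightarrow>
     (\<forall>\<theta>. bayes_params U r G \<theta> \<longrightarrow>
        (\<exists>\<theta>'. bayes_params U r G' \<theta>' \<and> joint_dist U r G' \<theta>' = joint_dist U r G \<theta>)) \<and>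
     (\<forall>\<theta>'. bayes_params U r G' \<theta>' \<longrightarrow>
        (\<exists>\<theta>. bayes_params U r G \<theta> \<and> joint_dist U r G \<theta> = joint_dist U r G' \<theta>'))"

text \<open>The structure hypothesis of \<open>G\<close>, as an event: the set of those distributions that
  factor according to \<open>G\<close>.\<close>

definition struct_hyp ::
  "'v set \<Rightarrow> ('v \<Rightarrow> nat) \<Rightarrow> ('v \<times> 'v) set \<Rightarrow> (('v \<Rightarrow> nat) \<Rightarrow> real) set" where
  "struct_hyp U r G = {joint_dist U r G \<theta> | \<theta>. bayes_params U r G \<theta>}"

text \<open>A prior gives each structure hypothesis a probability. No normalisation over the
  hypotheses is imposed, since as events they need not be disjoint; priors that do sum
  to \<open>1\<close> are a special case.\<close>

definition hyp_prior ::
  "'v set \<Rightarrow> ('v \<Rightarrow> nat) \<Rightarrow> ((('v \<Rightarrow> nat) \<Rightarrow> real) set \<Rightarrow> real) \<Rightarrow> bool" where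
  "hyp_prior U r p \<longleftrightarrow>
     (\<forall>G. dag U G \<longrightarrow> 0 \<le> p (struct_hyp U r G) \<and> p (struct_hyp U r G) \<le> 1)"

definition database :: "'v set \<Rightarrow> ('v \<Rightarrow> nat) \<Rightarrow> ('v \<Rightarrow> nat) list \<Rightarrow> bool" where
  "database U r C \<longleftrightarrow> C \<noteq> [] \<and> set C \<subseteq> configs r U"

text \<open>\<open>case_count G C x j k\<close> is the count \<open>N\<^sub>i\<^sub>j\<^sub>k\<close> with \<open>x\<close> as the \<open>i\<close>-th variable and the
  parent configuration \<open>j\<close> itself in place of its index.\<close>

definition case_count ::
  "('v \<times> 'v) set \<Rightarrow> ('v \<Rightarrow> nat) list \<Rightarrow> 'v \<Rightarrow> ('v \<Rightarrow> nat) \<Rightarrow> nat \<Rightarrow> nat" where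
  "case_count G C x j k =
     length (filter (\<lambda>a. a x = k \<and> restrict a (parents G x) = j) C)"

text \<open>Terms with \<open>N\<^sub>i\<^sub>j\<^sub>k = 0\<close> vanish because of their first factor.\<close>

definition entropy_of ::
  "'v set \<Rightarrow> ('v \<Rightarrow> nat) \<Rightarrow> ('v \<times> 'v) set \<Rightarrow> ('v \<Rightarrow> nat) list \<Rightarrow> real" where
  "entropy_of U r G C =
     - (\<Sum>x\<in>U. \<Sum>j\<in>configs r (parents G x). \<Sum>k<r x.
          real (case_count G C x j k) / real (length C) *
          ln (real (case_count G C x j k) / real (\<Sum>k'<r x. case_count G C x j k')))"

definition Dim :: "'v set \<Rightarrow> ('v \<Rightarrow> nat) \<Rightarrow> ('v \<times> 'v) set \<Rightarrow> nat" where
  "Dim U r G = (\<Sum>x\<in>U. (r x - 1) * (\<Prod>y\<in>parents G x. r y))"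

definition log_prob :: "real \<Rightarrow> ereal" where
  "log_prob q = (if q = 0 then -\<infinity> else ereal (ln q))"

definition M_MDL1 ::
  "'v set \<Rightarrow> ('v \<Rightarrow> nat) \<Rightarrow> ((('v \<Rightarrow> nat) \<Rightarrow> real) set \<Rightarrow> real)
    \<Rightarrow> ('v \<times> 'v) set \<Rightarrow> ('v \<Rightarrow> nat) list \<Rightarrow> ereal" where
  "M_MDL1 U r p G C =
     log_prob (p (struct_hyp U r G))
     - ereal (real (length C) * entropy_of U r G C)
     - ereal (1 / 2 * real (Dim U r G) * ln (real (length C)))"

definition score_equivalent ::
  "'v set \<Rightarrow> ('v \<Rightarrow> nat) \<Rightarrow> (('v \<times> 'v) set \<Rightarrow> ('v \<Rightarrow> nat) list \<Rightarrow> ereal) \<Rightarrow> bool" where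
  "score_equivalent U r M \<longleftrightarrow>
     (\<forall>G G' C. dag U G \<longrightarrow> dag U G' \<longrightarrow> database U r C \<longrightarrow> dag_equiv U r G G' \<longrightarrow>
        M G C = M G' C)"

end

theory Submission
  imports Defs
begin

text \<open>All three terms of the metric depend only on the set of distributions that factor according
  to the dag, which equivalent dags share. For the prior this is immediate. By Gibbs' inequality
  \<open>- N H\<close> is the maximal log-likelihood over that set. Finally, \<open>Dim\<close> is the sum of
  \<open>\<Prod>y\<in>S. (r y - 1)\<close> over the sets \<open>S = {x} \<union> T\<close> with \<open>T\<close> consisting of parents of \<open>x\<close>, and these are
  exactly the nonempty sets \<open>S\<close> for which a suitable perturbation of the uniform distribution by a
  pure interaction on \<open>S\<close> factors according to the dag.\<close>

section \<open>Sums over configurations\<close>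

lemma configs_subset: "a \<in> configs r U \<Longrightarrow> A \<subseteq> U \<Longrightarrow> restrict a A \<in> configs r A"
  by (auto simp: configs_def PiE_iff)

lemma finite_configs: "finite A \<Longrightarrow> finite (configs r A)"
  by (auto simp: configs_def intro!: finite_PiE)

lemma sum_configs_insert:
  assumes "z \<notin> W"
  shows "(\<Sum>a\<in>configs r (insert z W). F a) = (\<Sum>b\<in>configs r W. \<Sum>k<r z. F (b(z := k)))"
proof -
  have "(\<Sum>a\<in>configs r (insert z W). F a)
      = (\<Sum>(k, b)\<in>{..<r z} \<times> configs r W. F (b(z := k)))"
    unfolding configs_def PiE_insert_eq
    by (subst sum.reindex[OF inj_combinator[OF assms]]) (auto simp: case_prod_unfold)
  also have "\<dots> = (\<Sum>k<r z. \<Sum>b\<in>configs r W. F (b(z := k)))"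
    by (simp add: sum.cartesian_product)
  also have "\<dots> = (\<Sum>b\<in>configs r W. \<Sum>k<r z. F (b(z := k)))"
    by (rule sum.swap)
  finally show ?thesis .
qed

lemma restrict_fun_upd_notin: "z \<notin> P \<Longrightarrow> restrict (b(z := k)) P = restrict b P"
  by (auto simp: restrict_def)

text \<open>Summing over the coordinate \<open>z\<close> first, \<open>G\<close> is a constant
  factor and the sum of \<open>h\<close> over the states of \<open>z\<close> vanishes.\<close>

lemma sum_configs_contrast_zero:
  fixes G :: "('v \<Rightarrow> nat) \<Rightarrow> real"
  assumes "z \<in> W" and "(\<Sum>k<r z. h k) = 0" and "\<And>b k. G (b(z := k)) = G b"
  shows "(\<Sum>a\<in>configs r W. G a * h (a z)) = 0"
proof -
  have "(\<Sum>a\<in>configs r (insert z (W - {z})). G a * h (a z)) = 0"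
    by (subst sum_configs_insert) (simp_all add: assms flip: sum_distrib_left)
  then show ?thesis
    using assms(1) by (simp add: insert_absorb)
qed

section \<open>Acyclicity and marginals on ancestral sets\<close>

lemma dag_self_notin_parents: "dag U E \<Longrightarrow> x \<notin> parents E x"
  by (auto simp: dag_def parents_def acyclic_def)

lemma dag_parents_subset: "dag U E \<Longrightarrow> parents E x \<subseteq> U"
  by (auto simp: dag_def parents_def)

text \<open>The reachability order of a finite acyclic relation is well-founded in both directions.
  The sink is taken for reachability rather than for single arcs because paths between elements of
  \<open>S\<close> may leave \<open>S\<close>.\<close>

lemma acyclic_sink:
  assumes "finite E" "acyclic E" "S \<noteq> {}"
  obtains x where "x \<in> S" "\<And>s. s \<in> S \<Longrightarrow> (x, s) \<notin> E\<^sup>+"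
proof -
  have "wf ((E\<inverse>)\<^sup>+)"
    using assms by (intro wf_trancl finite_acyclic_wf_converse)
  with assms(3) show ?thesis
    by (metis (no_types, lifting) converseI ex_in_conv trancl_converse that wf_eq_minimal)
qed

text \<open>The marginal of a network on a parent-closed set \<open>A\<close> is the network
  restricted to \<open>A\<close>. A variable outside \<open>A\<close> that has no child left is
  summed out: its own factor sums to 1 and nothing else depends on it. Iterating this removes all of
  \<open>W - A\<close>.\<close>

lemma sum_configs_ancestral:
  fixes \<theta> :: "'v \<Rightarrow> ('v \<Rightarrow> nat) \<Rightarrow> nat \<Rightarrow> real"
  assumes "finite E" "acyclic E" and "finite W" "A \<subseteq> W"
    and "bayes_params W r E \<theta>"
    and "\<And>y. y \<in> W \<Longrightarrow> parents E y \<subseteq> W"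
    and A: "\<And>y. y \<in> A \<Longrightarrow> parents E y \<subseteq> A"
    and \<phi>: "\<And>a b. (\<And>y. y \<in> A \<Longrightarrow> a y = b y) \<Longrightarrow> \<phi> a = \<phi> b"
  shows "(\<Sum>a\<in>configs r W. \<phi> a * (\<Prod>y\<in>W. \<theta> y (restrict a (parents E y)) (a y)))
       = (\<Sum>a\<in>configs r A. \<phi> a * (\<Prod>y\<in>A. \<theta> y (restrict a (parents E y)) (a y)))"
  using assms(3-6)
proof (induction "card (W - A)" arbitrary: W)
  case 0
  then have "W = A" by auto
  then show ?case by simp
next
  case (Suc n)
  then have "W - A \<noteq> {}" by force
  from acyclic_sink[OF assms(1,2) this] obtain z
    where z: "z \<in> W - A" and sink: "\<And>s. s \<in> W - A \<Longrightarrow> (z, s) \<notin> E\<^sup>+"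
    by metis
  define V where "V = W - {z}"
  have W: "W = insert z V" and zV: "z \<notin> V" and "A \<subseteq> V" and finV: "finite V"
    using z Suc.prems by (auto simp: V_def)
  \<comment> \<open>A child of \<open>z\<close> in \<open>W - A\<close> contradicts the choice of
    the sink; a child in \<open>A\<close> would force \<open>z\<close> into the parent-closed set
    \<open>A\<close>.\<close>
  have nopar: "z \<notin> parents E y" if "y \<in> W" for y
    using A[of y] sink[of y] z that by (auto simp: parents_def)
  have parV: "parents E y \<subseteq> V" if "y \<in> W" for y
    using nopar[OF that] Suc.prems(4)[OF that] by (auto simp: V_def)
  have par1: "(\<Sum>k<r z. \<theta> z (restrict b (parents E z)) k) = 1" if "b \<in> configs r V" for b
    using Suc.prems(3) configs_subset[OF that parV[of z]] by (auto simp: bayes_params_def W)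
  have "(\<Sum>a\<in>configs r W. \<phi> a * (\<Prod>y\<in>W. \<theta> y (restrict a (parents E y)) (a y)))
      = (\<Sum>b\<in>configs r V. \<Sum>k<r z. \<phi> b * (\<Prod>y\<in>V. \<theta> y (restrict b (parents E y)) (b y))
            * \<theta> z (restrict b (parents E z)) k)"
    unfolding W sum_configs_insert[OF zV]
  proof (intro sum.cong refl)
    fix b k
    have "\<phi> (b(z := k)) = \<phi> b"
      using z by (intro \<phi>) auto
    moreover have "(\<Prod>y\<in>V. \<theta> y (restrict (b(z := k)) (parents E y)) ((b(z := k)) y))
        = (\<Prod>y\<in>V. \<theta> y (restrict b (parents E y)) (b y))"
      using zV nopar by (intro prod.cong) (auto simp: W restrict_fun_upd_notin)
    ultimately show "\<phi> (b(z := k)) * (\<Prod>y\<in>insert z V. \<theta> y (restrict (b(z := k)) (parents E y))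
          ((b(z := k)) y))
        = \<phi> b * (\<Prod>y\<in>V. \<theta> y (restrict b (parents E y)) (b y)) * \<theta> z (restrict b (parents E z)) k"
      using zV finV nopar[of z] by (simp add: W restrict_fun_upd_notin)
  qed
  also have "\<dots> = (\<Sum>b\<in>configs r V. \<phi> b * (\<Prod>y\<in>V. \<theta> y (restrict b (parents E y)) (b y)))"
    by (intro sum.cong) (simp_all add: par1 flip: sum_distrib_left)
  also have "\<dots> = (\<Sum>a\<in>configs r A. \<phi> a * (\<Prod>y\<in>A. \<theta> y (restrict a (parents E y)) (a y)))"
  proof (rule Suc.hyps(1))
    have "W - A = insert z (V - A)" "z \<notin> V - A"
      using z by (auto simp: V_def)
    then show "n = card (V - A)"
      using Suc.hyps(2) finV by simp
    show "bayes_params V r E \<theta>"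
      using Suc.prems(3) by (auto simp: bayes_params_def V_def)
  qed (use finV \<open>A \<subseteq> V\<close> parV in \<open>auto simp: V_def\<close>)
  finally show ?case .
qed

section \<open>The number of parameters\<close>

text \<open>On sets with at least two elements, the indicator of this system is the characteristic
  imset of the dag. The choice \<open>T = {}\<close> puts the singletons in as well.\<close>

definition families :: "'v set \<Rightarrow> ('v \<times> 'v) set \<Rightarrow> 'v set set" where
  "families U E = {insert x T | x T. x \<in> U \<and> T \<subseteq> parents E x}"

text \<open>Expand each \<open>r y = (r y - 1) + 1\<close>; a family has a unique sink, so it arises only once.\<close>

lemma Dim_eq_sum_families:
  assumes "finite U" "dag U E" and r: "\<And>x. x \<in> U \<Longrightarrow> 1 \<le> r x"
  shows "Dim U r E = (\<Sum>S\<in>families U E. \<Prod>y\<in>S. r y - 1)"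
proof -
  have fin: "finite (parents E x)" for x
    using dag_parents_subset[OF assms(2)] assms(1) finite_subset by metis
  have "(\<Prod>y\<in>parents E x. r y) = (\<Sum>T\<in>Pow (parents E x). \<Prod>y\<in>T. r y - 1)" for x
  proof -
    have "(\<Prod>y\<in>parents E x. r y) = (\<Prod>y\<in>parents E x. (r y - 1) + 1)"
      using r dag_parents_subset[OF assms(2)]
      by (intro prod.cong refl) (metis le_add_diff_inverse2 subsetD)
    then show ?thesis
      using prod_add[OF fin, of "\<lambda>y. r y - 1" "\<lambda>_. 1" x] by simp
  qed
  then have "Dim U r E = (\<Sum>x\<in>U. \<Sum>T\<in>Pow (parents E x). (r x - 1) * (\<Prod>y\<in>T. r y - 1))"
    by (simp add: Dim_def sum_distrib_left)
  also have "\<dots> = (\<Sum>x\<in>U. \<Sum>T\<in>Pow (parents E x). \<Prod>y\<in>insert x T. r y - 1)"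
  proof (intro sum.cong refl)
    fix x T assume "T \<in> Pow (parents E x)"
    then have "finite T" "x \<notin> T"
      using fin finite_subset dag_self_notin_parents[OF assms(2)] by auto
    then show "(r x - 1) * (\<Prod>y\<in>T. r y - 1) = (\<Prod>y\<in>insert x T. r y - 1)"
      by simp
  qed
  also have "\<dots> = (\<Sum>(x, T)\<in>Sigma U (\<lambda>x. Pow (parents E x)). \<Prod>y\<in>insert x T. r y - 1)"
    using assms(1) fin by (subst sum.Sigma) auto
  also have "\<dots> = (\<Sum>S\<in>families U E. \<Prod>y\<in>S. r y - 1)"
  proof -
    have "inj_on (\<lambda>(x, T). insert x T) (Sigma U (\<lambda>x. Pow (parents E x)))"
    proof (rule inj_onI, clarify)
      fix x T x' T'
      assume *: "insert x T = insert x' T'" "T \<subseteq> parents E x" "T' \<subseteq> parents E x'"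
      have "x = x'"
      proof (rule ccontr)
        assume "x \<noteq> x'"
        then have "(x, x') \<in> E" "(x', x) \<in> E"
          using * by (auto simp: parents_def)
        then have "(x, x) \<in> E\<^sup>+"
          by (meson trancl.simps)
        then show False
          using assms(2) by (auto simp: dag_def acyclic_def)
      qed
      moreover have "x \<notin> T" "x' \<notin> T'"
        using * dag_self_notin_parents[OF assms(2)] by blast+
      ultimately show "x = x' \<and> T = T'"
        using * by (metis insert_ident)
    qed
    moreover have "families U E = (\<lambda>(x, T). insert x T) ` Sigma U (\<lambda>x. Pow (parents E x))"
      by (auto simp: families_def image_def)
    ultimately show ?thesis
      by (simp add: sum.reindex case_prod_unfold)
  qed
  finally show ?thesis .
qed

text \<open>What matters is that the values sum to 0 over any two or more states, so that the
  contrast has mean 0 under the uniform distribution, that they are bounded by 1, so that perturbed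
  probabilities stay nonnegative, and that state 0 has a nonzero value.\<close>

definition contrast :: "nat \<Rightarrow> real" where
  "contrast k = (if k = 0 then 1 else if k = 1 then -1 else 0)"

lemma sum_contrast:
  assumes "2 \<le> n"
  shows "(\<Sum>k<n. contrast k) = 0"
proof -
  have "{..<n} = insert 0 (insert 1 {2..<n})"
    using assms by auto
  then show ?thesis
    by (simp add: contrast_def)
qed

lemma abs_prod_contrast_le: "\<bar>\<Prod>y\<in>S. contrast (a y)\<bar> \<le> 1"
  unfolding abs_prod by (rule prod_le_1) (auto simp: contrast_def)

text \<open>Under this distribution the variables in any set not containing \<open>S\<close> are independent and
  uniform.\<close>

definition contrast_dist :: "'v set \<Rightarrow> ('v \<Rightarrow> nat) \<Rightarrow> 'v set \<Rightarrow> ('v \<Rightarrow> nat) \<Rightarrow> real" where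
  "contrast_dist U r S = (\<lambda>a\<in>configs r U. (1 + (\<Prod>y\<in>S. contrast (a y))) / (\<Prod>y\<in>U. real (r y)))"

text \<open>The whole interaction can be put into the conditional distribution of the sink
  \<open>x\<close>, which sees all of \<open>T\<close> among its parents. Every other variable is
  uniform and ignores its parents.\<close>

lemma contrast_dist_in_struct_hyp:
  assumes "finite U" "dag U E" and r: "\<And>x. x \<in> U \<Longrightarrow> 2 \<le> r x" and S: "S \<in> families U E"
  shows "contrast_dist U r S \<in> struct_hyp U r E"
proof -
  obtain x T where x: "x \<in> U" "T \<subseteq> parents E x" and S': "S = insert x T"
    using S by (auto simp: families_def)
  have T: "x \<notin> T" "finite T"
    using x dag_self_notin_parents[OF assms(2)] dag_parents_subset[OF assms(2)] assms(1)
      finite_subset by (blast, metis)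
  define \<theta> where "\<theta> y c k = (if y = x then (1 + (\<Prod>t\<in>T. contrast (c t)) * contrast k) / real (r y)
    else 1 / real (r y))" for y and c :: "'a \<Rightarrow> nat" and k
  have "bayes_params U r E \<theta>"
    unfolding bayes_params_def
  proof (intro ballI conjI allI impI)
    fix y c k assume y: "y \<in> U"
    have "\<bar>(\<Prod>t\<in>T. contrast (c t)) * contrast k\<bar> \<le> 1 * 1"
      unfolding abs_mult by (intro mult_mono abs_prod_contrast_le) (auto simp: contrast_def)
    then show "0 \<le> \<theta> y c k"
      by (auto simp: \<theta>_def)
  next
    fix y c assume y: "y \<in> U"
    have "(\<Sum>k<r y. 1 + (\<Prod>t\<in>T. contrast (c t)) * contrast k) = real (r y)"
      using sum_contrast[OF r[OF y]] by (simp add: sum.distrib flip: sum_distrib_left)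
    then show "(\<Sum>k<r y. \<theta> y c k) = 1"
      using r[OF y] by (cases "y = x") (simp_all add: \<theta>_def flip: sum_divide_distrib)
  qed
  moreover have "joint_dist U r E \<theta> = contrast_dist U r S"
  proof -
    have "(\<Prod>y\<in>U. \<theta> y (restrict a (parents E y)) (a y))
        = (1 + (\<Prod>y\<in>S. contrast (a y))) / (\<Prod>y\<in>U. real (r y))" for a
    proof -
      have "(\<Prod>t\<in>T. contrast (restrict a (parents E x) t)) = (\<Prod>t\<in>T. contrast (a t))"
        using x by (intro prod.cong) auto
      then have "\<theta> x (restrict a (parents E x)) (a x) = (1 + (\<Prod>y\<in>S. contrast (a y))) / real (r x)"
        using T by (simp add: \<theta>_def S' mult.commute)
      moreover have "(\<Prod>y\<in>U - {x}. \<theta> y (restrict a (parents E y)) (a y))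
          = (\<Prod>y\<in>U - {x}. 1 / real (r y))"
        by (intro prod.cong) (auto simp: \<theta>_def)
      ultimately show ?thesis
        using x(1) assms(1) by (simp add: prod.remove prod_dividef)
    qed
    then show ?thesis
      by (simp add: joint_dist_def contrast_dist_def)
  qed
  ultimately show ?thesis
    unfolding struct_hyp_def by (metis (mono_tags, lifting) mem_Collect_eq)
qed

text \<open>Let \<open>x\<close> be a sink of \<open>S\<close>, \<open>h\<close> the contrast of \<open>x\<close> and \<open>m\<close> its conditional mean given the
  parents of \<open>x\<close>. If some element of \<open>S - {x}\<close> is not a parent of \<open>x\<close>, then \<open>x\<close> is independent of its
  parents, so \<open>E[m\<^sup>2] = E[m h] = 0\<close>. By the local Markov property the expectation of the product
  of the contrasts over \<open>S\<close> then vanishes too, which it does not.\<close>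

lemma families_if_contrast_dist:
  assumes finU: "finite U" and dag: "dag U E" and r: "\<And>x. x \<in> U \<Longrightarrow> 2 \<le> r x"
    and S: "S \<subseteq> U" "S \<noteq> {}" and hyp: "contrast_dist U r S \<in> struct_hyp U r E"
  shows "S \<in> families U E"
proof (rule ccontr)
  assume nfam: "S \<notin> families U E"
  obtain \<theta> where \<theta>: "bayes_params U r E \<theta>" and joint: "joint_dist U r E \<theta> = contrast_dist U r S"
    using hyp by (auto simp: struct_hyp_def)
  have EU: "E \<subseteq> U \<times> U" and acyc: "acyclic E"
    using dag by (auto simp: dag_def)
  have finE: "finite E"
    using EU finU by (meson finite_SigmaI finite_subset)
  have finS: "finite S"
    using S finU finite_subset by blast
  obtain x where x: "x \<in> S" and sink: "\<And>s. s \<in> S \<Longrightarrow> (x, s) \<notin> E\<^sup>+"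
    using acyclic_sink[OF finE acyc S(2)] by metis
  have xU: "x \<in> U"
    using x S by auto
  have "\<not> S - {x} \<subseteq> parents E x"
  proof
    assume "S - {x} \<subseteq> parents E x"
    with xU have "insert x (S - {x}) \<in> families U E"
      by (auto simp only: families_def)
    with nfam x show False
      by (simp add: insert_absorb)
  qed
  then obtain y where y: "y \<in> S" "y \<noteq> x" "y \<notin> parents E x"
    by auto
  \<comment> \<open>\<open>A\<close> is the ancestral closure of \<open>S\<close>. As
    \<open>x\<close> is a sink of \<open>S\<close> for reachability, it has no child in
    \<open>A\<close>, so within \<open>A\<close> it can be summed out first.\<close>
  define A where "A = {y. \<exists>s\<in>S. (y, s) \<in> E\<^sup>*}"
  have SA: "S \<subseteq> A"
    by (auto simp: A_def)
  have AU: "A \<subseteq> U"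
  proof
    fix y assume "y \<in> A"
    then obtain s where "s \<in> S" "(y, s) \<in> E\<^sup>*"
      by (auto simp: A_def)
    then show "y \<in> U"
      using EU S by (auto elim: converse_rtranclE)
  qed
  have parA: "parents E z \<subseteq> A" if "z \<in> A" for z
    using that by (auto simp: A_def parents_def intro: converse_rtrancl_into_rtrancl)
  have xpar: "x \<notin> parents E z" if "z \<in> A" for z
    using that sink by (auto simp: A_def parents_def intro: rtrancl_into_trancl2)
  have xA: "x \<in> A"
    using x SA by auto
  \<comment> \<open>\<open>P\<close> is the joint mass function, \<open>H\<close> the pure
    interaction on \<open>S\<close>, \<open>R\<close> the number of joint configurations and
    \<open>m\<close> the conditional mean of the contrast of \<open>x\<close>.\<close>
  define P where "P a = (\<Prod>z\<in>U. \<theta> z (restrict a (parents E z)) (a z))" for a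
  define H where "H a = (\<Prod>z\<in>S. contrast (a z))" for a :: "'a \<Rightarrow> nat"
  define R where "R = (\<Prod>z\<in>U. real (r z))"
  define m where "m a = (\<Sum>k<r x. \<theta> x (restrict a (parents E x)) k * contrast k)" for a
  have R: "R > 0"
    unfolding R_def using r by (intro prod_pos) force
  have P: "P a = (1 + H a) / R" if "a \<in> configs r U" for a
    using fun_cong[OF joint, of a] that
    by (simp add: P_def H_def R_def joint_dist_def contrast_dist_def)
  have finA: "finite (A - {x})"
    using AU finU finite_subset by blast
  have m_cong: "m a = m b" if "\<And>z. z \<in> A - {x} \<Longrightarrow> a z = b z" for a b
  proof -
    have "restrict a (parents E x) = restrict b (parents E x)"
      using that parA[OF xA] xpar[OF xA] by (intro restrict_ext) blast
    then show ?thesis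
      by (simp add: m_def)
  qed
  have m_upd: "m (b(z := k)) = m b" if "z \<notin> parents E x" for b z k
    by (simp add: m_def restrict_fun_upd_notin[OF that])
  \<comment> \<open>Local Markov property: the residual \<open>contrast (a x) - m a\<close> is
    orthogonal to every function of the variables in \<open>A - {x}\<close>. After reduction to
    \<open>A\<close>, summing out \<open>x\<close> turns the residual into
    \<open>m b - m b\<close>.\<close>
  have markov: "(\<Sum>a\<in>configs r U. \<phi> a * (contrast (a x) - m a) * P a) = 0"
    if \<phi>: "\<And>a b. (\<And>z. z \<in> A - {x} \<Longrightarrow> a z = b z) \<Longrightarrow> \<phi> a = \<phi> b" for \<phi>
  proof -
    have A: "A = insert x (A - {x})"
      using xA by auto
    have "(\<Sum>a\<in>configs r U. \<phi> a * (contrast (a x) - m a) * P a)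
        = (\<Sum>a\<in>configs r A. \<phi> a * (contrast (a x) - m a)
            * (\<Prod>z\<in>A. \<theta> z (restrict a (parents E z)) (a z)))"
      unfolding P_def
    proof (rule sum_configs_ancestral[OF finE acyc finU AU \<theta> dag_parents_subset[OF dag] parA])
      fix a b :: "'a \<Rightarrow> nat"
      assume ab: "\<And>y. y \<in> A \<Longrightarrow> a y = b y"
      then have "\<phi> a = \<phi> b" "m a = m b" "a x = b x"
        using xA by (auto intro!: \<phi> m_cong)
      then show "\<phi> a * (contrast (a x) - m a) = \<phi> b * (contrast (b x) - m b)"
        by simp
    qed auto
    also have "\<dots> = (\<Sum>b\<in>configs r (A - {x}). \<Sum>k<r x. \<phi> (b(x := k))
        * (contrast k - m (b(x := k)))
        * (\<Prod>z\<in>A. \<theta> z (restrict (b(x := k)) (parents E z)) ((b(x := k)) z)))"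
      by (subst A, subst sum_configs_insert) (simp_all add: A[symmetric])
    also have "\<dots> = 0"
    proof (rule sum.neutral, rule ballI)
      fix b assume b: "b \<in> configs r (A - {x})"
      define Q where "Q = (\<Prod>z\<in>A - {x}. \<theta> z (restrict b (parents E z)) (b z))"
      let ?t = "\<theta> x (restrict b (parents E x))"
      have one: "(\<Sum>k<r x. ?t k) = 1"
        using \<theta> xU configs_subset[OF b, of "parents E x"] parA[OF xA] xpar[OF xA]
        by (auto simp: bayes_params_def)
      have "(\<Prod>z\<in>A. \<theta> z (restrict (b(x := k)) (parents E z)) ((b(x := k)) z)) = ?t k * Q" for k
      proof -
        have "(\<Prod>z\<in>A - {x}. \<theta> z (restrict (b(x := k)) (parents E z)) ((b(x := k)) z)) = Q"
          unfolding Q_def using xpar by (intro prod.cong) (auto simp: restrict_fun_upd_notin)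
        then show ?thesis
          using finA xpar[OF xA] by (subst A) (simp add: restrict_fun_upd_notin del: insert_Diff_single)
      qed
      moreover have "\<phi> (b(x := k)) = \<phi> b" for k
        by (intro \<phi>) auto
      ultimately have "(\<Sum>k<r x. \<phi> (b(x := k)) * (contrast k - m (b(x := k)))
          * (\<Prod>z\<in>A. \<theta> z (restrict (b(x := k)) (parents E z)) ((b(x := k)) z)))
          = (\<Sum>k<r x. \<phi> b * Q * (?t k * contrast k - m b * ?t k))"
        by (simp add: m_upd[OF xpar[OF xA]] algebra_simps)
      also have "\<dots> = \<phi> b * Q * (m b - m b * (\<Sum>k<r x. ?t k))"
        by (simp add: m_def sum_subtractf flip: sum_distrib_left)
      finally show "(\<Sum>k<r x. \<phi> (b(x := k)) * (contrast k - m (b(x := k)))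
          * (\<Prod>z\<in>A. \<theta> z (restrict (b(x := k)) (parents E z)) ((b(x := k)) z))) = 0"
        using one by simp
    qed
    finally show ?thesis .
  qed
  have H_remove: "H a = (\<Prod>s\<in>S - {z}. contrast (a s)) * contrast (a z)" if "z \<in> S" for a z
    using that finS by (simp add: H_def prod.remove mult.commute)
  have prod_upd: "(\<Prod>s\<in>S - {z}. contrast ((b(z := k)) s)) = (\<Prod>s\<in>S - {z}. contrast (b s))"
    for b :: "'a \<Rightarrow> nat" and z k
    by (intro prod.cong) auto
  \<comment> \<open>Split \<open>P\<close> as \<open>(1 + H) / R\<close>. The constant part vanishes
    on summing over \<open>x\<close>, since \<open>m\<close> does not depend on \<open>x\<close>.
    The part with \<open>H\<close> vanishes on summing over \<open>y\<close>, which is neither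
    \<open>x\<close> nor a parent of \<open>x\<close>.\<close>
  have mh0: "(\<Sum>a\<in>configs r U. m a * contrast (a x) * P a) = 0"
  proof -
    have "(\<Sum>a\<in>configs r U. m a * contrast (a x)) = 0"
      using r xU xpar[OF xA] by (intro sum_configs_contrast_zero sum_contrast m_upd) auto
    moreover have "(\<Sum>a\<in>configs r U. (m a * contrast (a x) * (\<Prod>s\<in>S - {y}. contrast (a s)))
        * contrast (a y)) = 0"
    proof (rule sum_configs_contrast_zero)
      show "y \<in> U" "(\<Sum>k<r y. contrast k) = 0"
        using y S r by (auto intro: sum_contrast)
      show "m (b(y := k)) * contrast ((b(y := k)) x) * (\<Prod>s\<in>S - {y}. contrast ((b(y := k)) s))
          = m b * contrast (b x) * (\<Prod>s\<in>S - {y}. contrast (b s))" for b k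
        unfolding prod_upd using m_upd[OF y(3)] y(2) by simp
    qed
    ultimately have "(\<Sum>a\<in>configs r U. m a * contrast (a x) + m a * contrast (a x) * H a) = 0"
      by (simp add: sum.distrib H_remove[OF y(1)] mult.assoc)
    moreover have "(\<Sum>a\<in>configs r U. m a * contrast (a x) * P a)
        = (\<Sum>a\<in>configs r U. m a * contrast (a x) + m a * contrast (a x) * H a) / R"
      unfolding sum_divide_distrib by (intro sum.cong) (simp_all add: P field_simps)
    ultimately show ?thesis
      by simp
  qed
  \<comment> \<open>Taking \<open>m\<close> itself as the test function gives
    \<open>E[m h] = E[m\<^sup>2]\<close>, so the second moment vanishes and \<open>m\<close> is 0
    wherever \<open>P\<close> is nonzero.\<close>
  have "(\<Sum>a\<in>configs r U. m a * (contrast (a x) - m a) * P a) = 0"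
    by (rule markov) (rule m_cong)
  then have "(\<Sum>a\<in>configs r U. (m a)\<^sup>2 * P a) = 0"
    using mh0 by (simp add: algebra_simps sum_subtractf power2_eq_square)
  moreover have "P a \<ge> 0" if "a \<in> configs r U" for a
    using abs_prod_contrast_le[of a S] R P[OF that] by (simp add: H_def)
  ultimately have mP: "m a * P a = 0" if "a \<in> configs r U" for a
    using that finite_configs[OF finU] by (subst (asm) sum_nonneg_eq_0_iff) auto
  \<comment> \<open>Now the test function is the product of the other contrasts. The term with
    \<open>m\<close> drops out, leaving the expectation of \<open>H\<close>, which equals the sum of
    \<open>H\<^sup>2 / R\<close> because \<open>H\<close> itself sums to 0.\<close>
  have "(\<Sum>a\<in>configs r U. (\<Prod>s\<in>S - {x}. contrast (a s)) * (contrast (a x) - m a) * P a) = 0"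
    using SA by (intro markov prod.cong) auto
  moreover have "(\<Sum>a\<in>configs r U. (\<Prod>s\<in>S - {x}. contrast (a s)) * (contrast (a x) - m a) * P a)
      = (\<Sum>a\<in>configs r U. (H a + (H a)\<^sup>2) / R)"
  proof (intro sum.cong refl)
    fix a assume a: "a \<in> configs r U"
    have "(\<Prod>s\<in>S - {x}. contrast (a s)) * (contrast (a x) - m a) * P a
        = H a * P a - (\<Prod>s\<in>S - {x}. contrast (a s)) * (m a * P a)"
      by (simp only: H_remove[OF x] right_diff_distrib left_diff_distrib mult.assoc)
    also have "\<dots> = H a * P a"
      by (simp add: mP[OF a])
    also have "\<dots> = (H a + (H a)\<^sup>2) / R"
      by (simp add: P[OF a] power2_eq_square distrib_left)
    finally show "(\<Prod>s\<in>S - {x}. contrast (a s)) * (contrast (a x) - m a) * P a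
        = (H a + (H a)\<^sup>2) / R" .
  qed
  moreover have "(\<Sum>a\<in>configs r U. H a) = 0"
    unfolding H_remove[OF x]
    using r xU prod_upd by (intro sum_configs_contrast_zero sum_contrast) auto
  ultimately have "(\<Sum>a\<in>configs r U. (H a)\<^sup>2) = 0"
    using R by (simp add: sum.distrib flip: sum_divide_distrib)
  \<comment> \<open>At the all-zero configuration every contrast is 1, so the sum of squares cannot
    vanish.\<close>
  moreover have "(\<lambda>z\<in>U. 0) \<in> configs r U"
    using r by (force simp: configs_def)
  ultimately have "H (\<lambda>z\<in>U. 0) = 0"
    using finite_configs[OF finU] by (subst (asm) sum_nonneg_eq_0_iff) auto
  moreover have "H (\<lambda>z\<in>U. 0) = 1"
    using S by (auto simp: H_def contrast_def intro!: prod.neutral)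
  ultimately show False
    by simp
qed

text \<open>Membership of \<open>contrast_dist U r S\<close> in the hypothesis tests whether
  \<open>S\<close> is a family, and this test sees only the set of distributions.\<close>

lemma families_subset_if_struct_hyp_eq:
  assumes "finite U" "dag U E" "dag U E'" "\<And>x. x \<in> U \<Longrightarrow> 2 \<le> r x"
    and "struct_hyp U r E = struct_hyp U r E'"
  shows "families U E \<subseteq> families U E'"
proof
  fix S assume S: "S \<in> families U E"
  then have "S \<subseteq> U" "S \<noteq> {}"
    using dag_parents_subset[OF assms(2)] by (auto simp: families_def)
  then show "S \<in> families U E'"
    using families_if_contrast_dist contrast_dist_in_struct_hyp assms S by metis
qed

lemma Dim_eq_if_struct_hyp_eq:
  assumes "finite U" "dag U E" "dag U E'" "\<And>x. x \<in> U \<Longrightarrow> 2 \<le> r x"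
    and "struct_hyp U r E = struct_hyp U r E'"
  shows "Dim U r E = Dim U r E'"
proof -
  have "families U E = families U E'"
    using families_subset_if_struct_hyp_eq assms by (metis subset_antisym)
  moreover have "1 \<le> r x" if "x \<in> U" for x
    using assms(4)[OF that] by simp
  ultimately show ?thesis
    using Dim_eq_sum_families assms by metis
qed

section \<open>Entropy and maximum likelihood\<close>

definition likelihood :: "(('v \<Rightarrow> nat) \<Rightarrow> real) \<Rightarrow> ('v \<Rightarrow> nat) list \<Rightarrow> real" where
  "likelihood d C = prod_list (map d C)"

lemma likelihood_Nil: "likelihood d [] = 1"
  and likelihood_Cons: "likelihood d (a # C) = d a * likelihood d C"
  by (simp_all add: likelihood_def)

lemma case_count_Cons:
  "case_count G (a # C) x j k =
     of_bool (a x = k \<and> restrict a (parents G x) = j) + case_count G C x j k"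
  by (simp add: case_count_def)

lemma case_count_Nil: "case_count G [] x j k = 0"
  by (simp add: case_count_def)

text \<open>Cases are grouped by the values of \<open>x\<close> and its parents; each case falls
  into exactly one such cell.\<close>

lemma sum_list_eq_sum_case_count:
  fixes f :: "('v \<Rightarrow> nat) \<Rightarrow> nat \<Rightarrow> real"
  assumes "finite U" "dag U G" "x \<in> U" "set C \<subseteq> configs r U"
  shows "(\<Sum>a\<leftarrow>C. f (restrict a (parents G x)) (a x))
    = (\<Sum>j\<in>configs r (parents G x). \<Sum>k<r x. real (case_count G C x j k) * f j k)"
  using assms(4)
proof (induction C)
  case Nil
  then show ?case by (simp add: case_count_Nil)
next
  case (Cons a C)
  let ?J = "configs r (parents G x)" and ?j = "restrict a (parents G x)"
  have a: "a \<in> configs r U"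
    using Cons.prems by auto
  have fin: "finite ?J"
    using finite_configs dag_parents_subset[OF assms(2)] assms(1) finite_subset by metis
  have "(\<Sum>j\<in>?J. \<Sum>k<r x. of_bool (a x = k \<and> ?j = j) * f j k)
      = (\<Sum>j\<in>?J. if ?j = j then \<Sum>k<r x. if a x = k then f j k else 0 else 0)"
    by (intro sum.cong refl) (auto intro!: sum.cong)
  also have "\<dots> = f ?j (a x)"
    using fin configs_subset[OF a dag_parents_subset[OF assms(2)]] a assms(3)
    by (auto simp: sum.delta' configs_def PiE_iff)
  finally show ?case
    using Cons by (simp add: case_count_Cons distrib_right sum.distrib del: restrict_apply)
qed

lemma length_entropy_of:
  assumes "C \<noteq> []"
  shows "- (real (length C) * entropy_of U r G C)
    = (\<Sum>x\<in>U. \<Sum>j\<in>configs r (parents G x). \<Sum>k<r x. real (case_count G C x j k) *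
        ln (real (case_count G C x j k) / real (\<Sum>k'<r x. case_count G C x j k')))"
  using assms by (simp add: entropy_of_def sum_distrib_left)

text \<open>Positivity of the factors that occur in the data lets the product be written as an
  exponential. Exchanging the sums over cases and variables then allows grouping by cells.\<close>

lemma ln_likelihood_joint_dist:
  assumes "finite U" "dag U G" "set C \<subseteq> configs r U"
    and pos: "\<And>a x. a \<in> set C \<Longrightarrow> x \<in> U \<Longrightarrow> 0 < \<theta> x (restrict a (parents G x)) (a x)"
  shows "likelihood (joint_dist U r G \<theta>) C = exp (\<Sum>x\<in>U. \<Sum>j\<in>configs r (parents G x). \<Sum>k<r x.
    real (case_count G C x j k) * ln (\<theta> x j k))"
proof -
  have "likelihood (joint_dist U r G \<theta>) C
      = exp (\<Sum>a\<leftarrow>C. \<Sum>x\<in>U. ln (\<theta> x (restrict a (parents G x)) (a x)))"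
    using assms(3) pos
  proof (induction C)
    case Nil
    then show ?case by (simp add: likelihood_Nil)
  next
    case (Cons a C)
    have "joint_dist U r G \<theta> a = exp (\<Sum>x\<in>U. ln (\<theta> x (restrict a (parents G x)) (a x)))"
      using Cons.prems by (simp add: joint_dist_def exp_sum assms(1) del: restrict_apply)
        (simp add: restrict_def)
    moreover have "likelihood (joint_dist U r G \<theta>) C
      = exp (\<Sum>a\<leftarrow>C. \<Sum>x\<in>U. ln (\<theta> x (restrict a (parents G x)) (a x)))"
      using Cons by (auto simp del: restrict_apply)
    ultimately show ?case
      by (simp add: likelihood_Cons exp_add del: restrict_apply)
  qed
  also have "(\<Sum>a\<leftarrow>C. \<Sum>x\<in>U. ln (\<theta> x (restrict a (parents G x)) (a x)))
      = (\<Sum>x\<in>U. \<Sum>a\<leftarrow>C. ln (\<theta> x (restrict a (parents G x)) (a x)))"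
    by (induction C) (simp_all add: sum.distrib)
  also have "\<dots> = (\<Sum>x\<in>U. \<Sum>j\<in>configs r (parents G x). \<Sum>k<r x.
      real (case_count G C x j k) * ln (\<theta> x j k))"
    using assms by (intro sum.cong sum_list_eq_sum_case_count) auto
  finally show ?thesis .
qed

section \<open>The likelihood bound and its attainment\<close>

lemma case_count_pos_iff:
  "case_count G C x j k > 0 \<longleftrightarrow> (\<exists>a\<in>set C. a x = k \<and> restrict a (parents G x) = j)"
  by (auto simp: case_count_def filter_empty_conv)

text \<open>Gibbs' inequality for unnormalised counts: apply \<open>ln u \<le> u - 1\<close> to the
  ratio of \<open>t k\<close> to the observed fraction, weighted by \<open>N k\<close>. The
  resulting upper bounds add up to 0.\<close>

lemma gibbs_counts:
  fixes N :: "'k \<Rightarrow> nat" and t :: "'k \<Rightarrow> real"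
  assumes "finite K" and t: "\<And>k. k \<in> K \<Longrightarrow> 0 \<le> t k" "(\<Sum>k\<in>K. t k) = 1"
    and pos: "\<And>k. k \<in> K \<Longrightarrow> 0 < N k \<Longrightarrow> 0 < t k"
  shows "(\<Sum>k\<in>K. real (N k) * ln (t k)) \<le> (\<Sum>k\<in>K. real (N k) * ln (real (N k) / real (sum N K)))"
proof -
  have "(\<Sum>k\<in>K. real (N k) * ln (t k) - real (N k) * ln (real (N k) / real (sum N K)))
      \<le> (\<Sum>k\<in>K. real (sum N K) * t k - real (N k))"
  proof (intro sum_mono)
    fix k assume k: "k \<in> K"
    show "real (N k) * ln (t k) - real (N k) * ln (real (N k) / real (sum N K))
        \<le> real (sum N K) * t k - real (N k)"
    \<comment> \<open>A zero count makes the left side 0, and the right side is then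
      nonnegative.\<close>
    proof (cases "N k = 0")
      case True
      then show ?thesis using t k by (simp flip: of_nat_sum)
    next
      case False
      define M where "M = real (sum N K)"
      have "N k \<le> sum N K"
        using k assms(1) by (intro member_le_sum) auto
      then have M: "M > 0"
        using False unfolding M_def by linarith
      have tk: "t k > 0"
        using pos k False by simp
      have "ln (t k) - ln (real (N k) / M) = ln (t k * M / real (N k))"
        using False M tk by (simp add: ln_div ln_mult)
      also have "\<dots> \<le> t k * M / real (N k) - 1"
        using False M tk by (intro ln_le_minus_one) simp
      finally have "real (N k) * (ln (t k) - ln (real (N k) / M))
          \<le> real (N k) * (t k * M / real (N k) - 1)"
        by (intro mult_left_mono) auto
      also have "\<dots> = M * t k - real (N k)"
        using False by (simp add: field_simps)
      finally show ?thesis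
        by (simp add: M_def right_diff_distrib)
    qed
  qed
  also have "\<dots> = 0"
    using t(2) by (simp add: sum_subtractf flip: sum_distrib_left)
  finally show ?thesis
    by (simp add: sum_subtractf)
qed

lemma likelihood_le_exp_entropy:
  assumes "finite U" "dag U G" "database U r C" "bayes_params U r G \<theta>"
  shows "likelihood (joint_dist U r G \<theta>) C \<le> exp (- (real (length C) * entropy_of U r G C))"
proof (cases "\<forall>a\<in>set C. \<forall>x\<in>U. 0 < \<theta> x (restrict a (parents G x)) (a x)")
  case True
  have C: "C \<noteq> []" "set C \<subseteq> configs r U"
    using assms(3) by (auto simp: database_def)
  have "(\<Sum>x\<in>U. \<Sum>j\<in>configs r (parents G x). \<Sum>k<r x.
        real (case_count G C x j k) * ln (\<theta> x j k)) \<le> - (real (length C) * entropy_of U r G C)"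
    unfolding length_entropy_of[OF C(1)]
  proof (rule sum_mono, rule sum_mono, rule gibbs_counts)
    fix x j k
    assume "x \<in> U" "j \<in> configs r (parents G x)" "k \<in> {..<r x}" "0 < case_count G C x j k"
    then show "0 < \<theta> x j k"
      using True by (auto simp: case_count_pos_iff)
  qed (use assms(4) in \<open>auto simp: bayes_params_def\<close>)
  then show ?thesis
    using ln_likelihood_joint_dist[OF assms(1,2) C(2)] True by simp
next
  case False
  then obtain a x where a: "a \<in> set C" "x \<in> U" "\<not> 0 < \<theta> x (restrict a (parents G x)) (a x)"
    by auto
  have aU: "a \<in> configs r U"
    using a assms(3) by (auto simp: database_def)
  then have "a x < r x"
    using a by (auto simp: configs_def PiE_iff)
  then have "\<theta> x (restrict a (parents G x)) (a x) = 0"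
    using a assms(4) configs_subset[OF aU dag_parents_subset[OF assms(2)]]
    by (auto simp: bayes_params_def intro: antisym)
  then have "joint_dist U r G \<theta> a = 0"
    using a assms(1) aU by (auto simp: joint_dist_def)
  then have "likelihood (joint_dist U r G \<theta>) C = 0"
    using a by (auto simp: likelihood_def prod_list_zero_iff)
  then show ?thesis
    by simp
qed

lemma exp_entropy_attained:
  assumes "finite U" "dag U G" "database U r C" and r: "\<And>x. x \<in> U \<Longrightarrow> 1 \<le> r x"
  obtains d where "d \<in> struct_hyp U r G"
    "likelihood d C = exp (- (real (length C) * entropy_of U r G C))"
proof -
  have C: "C \<noteq> []" "set C \<subseteq> configs r U"
    using assms(3) by (auto simp: database_def)
  define N where "N x j = (\<Sum>k<r x. case_count G C x j k)" for x j
  \<comment> \<open>The observed fractions. For a parent configuration absent from the data they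
    would be 0/0, so the uniform distribution is used to keep the sum equal to 1; its choice does
    not affect the likelihood of \<open>C\<close>.\<close>
  define \<theta> where "\<theta> x j k = (if N x j = 0 then 1 / real (r x)
    else real (case_count G C x j k) / real (N x j))" for x j k
  have N: "0 < N x j" if "0 < case_count G C x j k" "k < r x" for x j k
    using that member_le_sum[of k "{..<r x}" "case_count G C x j"] by (simp add: N_def)
  have "bayes_params U r G \<theta>"
    unfolding bayes_params_def
  proof (intro ballI conjI allI impI)
    fix x j assume "x \<in> U"
    moreover have "(\<Sum>k<r x. real (case_count G C x j k)) = real (N x j)"
      by (simp add: N_def)
    ultimately show "(\<Sum>k<r x. \<theta> x j k) = 1"
      using r[of x] by (cases "N x j = 0") (simp_all add: \<theta>_def flip: sum_divide_distrib)
  qed (auto simp: \<theta>_def)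
  then have "joint_dist U r G \<theta> \<in> struct_hyp U r G"
    by (auto simp: struct_hyp_def)
  moreover have "likelihood (joint_dist U r G \<theta>) C
      = exp (- (real (length C) * entropy_of U r G C))"
  proof -
    have "likelihood (joint_dist U r G \<theta>) C
      = exp (\<Sum>x\<in>U. \<Sum>j\<in>configs r (parents G x). \<Sum>k<r x.
          real (case_count G C x j k) * ln (\<theta> x j k))"
    proof (rule ln_likelihood_joint_dist[OF assms(1,2) C(2)])
      fix a x assume a: "a \<in> set C" "x \<in> U"
      then have "a x < r x" "0 < case_count G C x (restrict a (parents G x)) (a x)"
        using C by (auto simp: configs_def PiE_iff case_count_pos_iff)
      then show "0 < \<theta> x (restrict a (parents G x)) (a x)"
        using N by (force simp: \<theta>_def)
    qed
    also have "(\<Sum>x\<in>U. \<Sum>j\<in>configs r (parents G x). \<Sum>k<r x.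
          real (case_count G C x j k) * ln (\<theta> x j k))
        = - (real (length C) * entropy_of U r G C)"
      unfolding length_entropy_of[OF C(1)]
    proof (intro sum.cong refl)
      fix x j k assume "k \<in> {..<r x}"
      then show "real (case_count G C x j k) * ln (\<theta> x j k) = real (case_count G C x j k) *
          ln (real (case_count G C x j k) / real (\<Sum>k'<r x. case_count G C x j k'))"
        using N[of x j k] by (cases "case_count G C x j k = 0") (auto simp: \<theta>_def N_def[symmetric])
    qed
    finally show ?thesis .
  qed
  ultimately show ?thesis
    using that by blast
qed

text \<open>The maximum likelihood distribution for \<open>G'\<close> also factors according to
  \<open>G\<close>, so its likelihood is at most the maximum for \<open>G\<close>.\<close>

lemma entropy_le_if_struct_hyp_eq:
  assumes "finite U" "dag U G" "dag U G'" "database U r C" "\<And>x. x \<in> U \<Longrightarrow> 1 \<le> r x"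
    and "struct_hyp U r G = struct_hyp U r G'"
  shows "real (length C) * entropy_of U r G C \<le> real (length C) * entropy_of U r G' C"
proof -
  obtain d where "d \<in> struct_hyp U r G'"
    and d: "likelihood d C = exp (- (real (length C) * entropy_of U r G' C))"
    using exp_entropy_attained assms(1,3-5) by metis
  then obtain \<theta> where "bayes_params U r G \<theta>" "d = joint_dist U r G \<theta>"
    unfolding assms(6)[symmetric] by (auto simp: struct_hyp_def)
  then show ?thesis
    using likelihood_le_exp_entropy[OF assms(1,2,4)] d by (metis exp_le_cancel_iff neg_le_iff_le)
qed

section \<open>Score equivalence\<close>

lemma struct_hyp_eq_if_dag_equiv: "dag_equiv U r G G' \<Longrightarrow> struct_hyp U r G = struct_hyp U r G'"
  unfolding dag_equiv_def struct_hyp_def by (auto, metis+)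

theorem theorem6:
  fixes U :: "'v set" and r :: "'v \<Rightarrow> nat"
    and p :: "(('v \<Rightarrow> nat) \<Rightarrow> real) set \<Rightarrow> real"
  assumes "finite U"
    and "\<And>x. x \<in> U \<Longrightarrow> 2 \<le> r x"
    and "hyp_prior U r p"
  shows "score_equivalent U r (M_MDL1 U r p)"
  unfolding score_equivalent_def
proof (intro allI impI)
  fix G G' C
  assume dag: "dag U G" "dag U G'" and C: "database U r C" and "dag_equiv U r G G'"
  then have hyp: "struct_hyp U r G = struct_hyp U r G'"
    by (simp add: struct_hyp_eq_if_dag_equiv)
  have r: "\<And>x. x \<in> U \<Longrightarrow> 1 \<le> r x"
    using assms(2) by force
  have "real (length C) * entropy_of U r G C = real (length C) * entropy_of U r G' C"
    using entropy_le_if_struct_hyp_eq[OF assms(1) dag(1) dag(2) C r hyp]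
      entropy_le_if_struct_hyp_eq[OF assms(1) dag(2) dag(1) C r hyp[symmetric]]
    by (rule antisym)
  moreover have "Dim U r G = Dim U r G'"
    using Dim_eq_if_struct_hyp_eq assms(1,2) dag hyp by metis
  ultimately show "M_MDL1 U r p G C = M_MDL1 U r p G' C"
    \<comment> \<open>The three terms agree one by one, so a prior of 0, with value
      \<open>-\<infinity>\<close>, needs no separate case.\<close>
    unfolding M_MDL1_def by (simp only: hyp)
qed

end
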